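(* Let $\mathcal{H} = \{H_n\}_{n=0}^{\infty}$ be a sequence of nonempty finite sets of positive integers. There exists a finite set $A$ of nonnegative integers that is a basis of order $\mathcal{H}$ or an asymptotic basis of order $\mathcal{H}$ if and only if \[ \liminf_{n\rightarrow\infty} \frac{\max(H_n)}{n} > 0. \]
   Context: For a set $A$ of nonnegative integers, a nonnegative integer $n$ and a positive integer $h$, $r_A(n,h)$ denotes the number of representations $n = a_1 + \cdots + a_h$ with $a_1,\ldots,a_h \in A$ and $a_1 \leq a_2 \leq \cdots \leq a_h$. For a nonempty finite set $H_n$ of positive integers, $r_A(n,H_n) = \sum_{h_n \in H_n} r_A(n,h_n)$. A set $A$ of nonnegative integers is a basis of order $\mathcal{H}$ if $r_A(n,H_n) \geq 1$ for all $n \geq 0$, and an asymptotic basis of order $\mathcal{H}$ if $r_A(n,H_n)\ge 1$ for all sufficiently large $n$. *)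

theory Defs
  imports Complex_Main "HOL-Library.Extended_Real"
begin

text \<open>A representation \<open>n = a\<^sub>1 + \<cdots> + a\<^sub>h\<close> with \<open>a\<^sub>1 \<le> \<cdots> \<le> a\<^sub>h\<close> is the sorted list
  of its summands.\<close>

definition reps :: "nat set \<Rightarrow> nat \<Rightarrow> nat \<Rightarrow> nat list set" where
  "reps A n h = {xs. length xs = h \<and> set xs \<subseteq> A \<and> sorted xs \<and> sum_list xs = n}"

text \<open>Every summand is at most \<open>n\<close>, so this set is finite even for infinite \<open>A\<close>, and its
  cardinality below is the true count.\<close>

lemma finite_reps: "finite (reps A n h)"
proof (rule finite_subset)
  show "reps A n h \<subseteq> {xs. set xs \<subseteq> {..n} \<and> length xs = h}"
    by (auto simp: reps_def member_le_sum_list)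
  show "finite {xs. set xs \<subseteq> {..n} \<and> length xs = h}"
    by (rule finite_lists_length_eq) simp
qed

definition rep_count :: "nat set \<Rightarrow> nat \<Rightarrow> nat \<Rightarrow> nat" where
  "rep_count A n h = card (reps A n h)"

definition rep_count_set :: "nat set \<Rightarrow> nat \<Rightarrow> nat set \<Rightarrow> nat" where
  "rep_count_set A n K = (\<Sum>h\<in>K. rep_count A n h)"

definition basis_of_order :: "nat set \<Rightarrow> (nat \<Rightarrow> nat set) \<Rightarrow> bool" where
  "basis_of_order A H \<longleftrightarrow> (\<forall>n. rep_count_set A n (H n) \<ge> 1)"

definition asymptotic_basis_of_order :: "nat set \<Rightarrow> (nat \<Rightarrow> nat set) \<Rightarrow> bool" where
  "asymptotic_basis_of_order A H \<longleftrightarrow> (\<forall>\<^sub>F n in sequentially. rep_count_set A n (H n) \<ge> 1)"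

end

theory Submission imports Defs "HOL-Library.Multiset" begin

text \<open>A sum of \<open>h\<close> elements of \<open>A\<close> is at most \<open>h * Max A\<close>, so a basis forces \<open>Max (H n) \<ge> n / Max A\<close>.
  Conversely, if \<open>n \<le> m * Max (H n)\<close> for all large \<open>n\<close>, then \<open>{0..m}\<close> is an asymptotic basis,
  because its \<open>h\<close>-fold sumset is \<open>{0..m * h}\<close>.\<close>

lemma sum_list_le_length_mult:
  fixes xs :: "nat list"
  assumes "\<And>x. x \<in> set xs \<Longrightarrow> x \<le> m"
  shows "sum_list xs \<le> m * length xs"
  using assms by (induction xs) (auto intro!: add_mono)

text \<open>Greedy choice: make the first summand as large as possible, \<open>min m n\<close>.
  Either this exhausts \<open>n\<close>, or it removes a full \<open>m\<close>; in both cases the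
  remainder fits into \<open>m * h\<close>.\<close>

lemma ex_list_bounded_sum_eq:
  fixes m n h :: nat
  assumes "n \<le> m * h"
  shows "\<exists>xs. length xs = h \<and> set xs \<subseteq> {..m} \<and> sum_list xs = n"
  using assms
proof (induction h arbitrary: n)
  case 0
  then show ?case by simp
next
  case (Suc h)
  have "n - min m n \<le> m * h"
    using Suc.prems by (auto simp: min_def)
  then obtain xs where "length xs = h" "set xs \<subseteq> {..m}" "sum_list xs = n - min m n"
    using Suc.IH by blast
  then show ?case
    by (intro exI[of _ "min m n # xs"]) auto
qed

lemma reps_atMost_nonempty:
  assumes "n \<le> m * h"
  shows "reps {..m} n h \<noteq> {}"
proof -
  obtain xs where "length xs = h" "set xs \<subseteq> {..m}" "sum_list xs = n"
    using ex_list_bounded_sum_eq[OF assms] by blast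
  \<comment> \<open>Sorting changes neither length nor entries, and the sum depends only on the
    multiset of entries.\<close>
  then have "sort xs \<in> reps {..m} n h"
    by (simp add: reps_def) (metis mset_sort sum_mset_sum_list)
  then show ?thesis by blast
qed

text \<open>A sum of naturals over a finite set vanishes iff every term does, and by
  \<open>finite_reps\<close> a cardinality 0 really means that no representation exists.\<close>

lemma rep_count_set_ge_1_iff:
  assumes "finite K"
  shows "rep_count_set A n K \<ge> 1 \<longleftrightarrow> (\<exists>h\<in>K. reps A n h \<noteq> {})"
proof -
  have "rep_count_set A n K = 0 \<longleftrightarrow> (\<forall>h\<in>K. reps A n h = {})"
    using assms by (simp add: rep_count_set_def rep_count_def finite_reps)
  then show ?thesis by (auto simp: Suc_le_eq)
qed

lemma basis_imp_asymptotic_basis: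
  "basis_of_order A H \<Longrightarrow> asymptotic_basis_of_order A H"
  by (simp add: basis_of_order_def asymptotic_basis_of_order_def)

lemma asymptotic_basis_imp_liminf_pos:
  assumes fin: "\<And>n. finite (H n)" and "finite A" and basis: "asymptotic_basis_of_order A H"
  shows "liminf (\<lambda>n. ereal (real (Max (H n)) / real n)) > 0"
proof -
  \<comment> \<open>Inserting 1 covers an empty \<open>A\<close> and \<open>A = {0}\<close>:
    \<open>m\<close> is always positive, so \<open>1 / m\<close> can serve as the lower
    bound.\<close>
  define m where "m = Max (insert 1 A)"
  have m: "m \<ge> 1" "\<And>a. a \<in> A \<Longrightarrow> a \<le> m"
    using \<open>finite A\<close> by (auto simp: m_def)
  have "\<forall>\<^sub>F n in sequentially. ereal (1 / real m) \<le> ereal (real (Max (H n)) / real n)"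
    using basis[unfolded asymptotic_basis_of_order_def] eventually_gt_at_top[of 0]
  proof eventually_elim
    case (elim n)
    then obtain h xs where "h \<in> H n" and xs: "xs \<in> reps A n h"
      using rep_count_set_ge_1_iff[OF fin] by blast
    have "n \<le> m * h"
      using sum_list_le_length_mult[of xs m] m(2) xs by (auto simp: reps_def)
    also have "\<dots> \<le> m * Max (H n)"
      using \<open>h \<in> H n\<close> fin by simp
    finally have "real n \<le> real m * real (Max (H n))"
      by (metis of_nat_le_iff of_nat_mult)
    \<comment> \<open>Here \<open>n > 0\<close> matters: at \<open>n = 0\<close> the quotient is 0
      by convention and the bound fails.\<close>
    then show ?case
      using m(1) elim(2) by (simp add: field_simps)
  qed
  then have "ereal (1 / real m) \<le> liminf (\<lambda>n. ereal (real (Max (H n)) / real n))"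
    by (rule Liminf_bounded)
  moreover have "0 < ereal (1 / real m)"
    using m(1) by simp
  ultimately show ?thesis by (rule less_le_trans[rotated])
qed

lemma liminf_pos_imp_asymptotic_basis:
  assumes fin: "\<And>n. finite (H n)" and nonempty: "\<And>n. H n \<noteq> {}"
    and pos: "liminf (\<lambda>n. ereal (real (Max (H n)) / real n)) > 0"
  shows "\<exists>m. asymptotic_basis_of_order {..m} H"
proof -
  \<comment> \<open>A real \<open>c\<close> strictly in between exists even if the liminf is
    infinite; the quotient eventually exceeds it.\<close>
  obtain c where c: "0 < c" "ereal c < liminf (\<lambda>n. ereal (real (Max (H n)) / real n))"
    using ereal_dense2[OF pos] by auto
  \<comment> \<open>Eventually \<open>n < Max (H n) / c\<close>, so any \<open>m\<close> above
    \<open>1 / c\<close> gives \<open>n \<le> m * Max (H n)\<close>.\<close>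
  obtain m :: nat where m: "1 / c < real m"
    using reals_Archimedean2 by blast
  have "\<forall>\<^sub>F n in sequentially. rep_count_set {..m} n (H n) \<ge> 1"
    using less_LiminfD[OF c(2)] eventually_gt_at_top[of 0]
  proof eventually_elim
    case (elim n)
    have "real n \<le> (1 / c) * real (Max (H n))"
      using elim c(1) by (simp add: field_simps)
    also have "\<dots> \<le> real m * real (Max (H n))"
      using m by (intro mult_right_mono) auto
    finally have "n \<le> m * Max (H n)"
      by (metis of_nat_le_iff of_nat_mult)
    then have "reps {..m} n (Max (H n)) \<noteq> {}"
      by (rule reps_atMost_nonempty)
    \<comment> \<open>The single choice \<open>h = Max (H n)\<close>, an element of
      \<open>H n\<close>, already makes the count positive.\<close>
    then show ?case
      using rep_count_set_ge_1_iff[OF fin] Max_in[OF fin nonempty] by blast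
  qed
  then show ?thesis
    unfolding asymptotic_basis_of_order_def by blast
qed

theorem theorem1:
  fixes H :: "nat \<Rightarrow> nat set"
  assumes "\<And>n. finite (H n)"
    and "\<And>n. H n \<noteq> {}"
    and "\<And>n h. h \<in> H n \<Longrightarrow> h > 0"
  shows "(\<exists>A. finite A \<and> (basis_of_order A H \<or> asymptotic_basis_of_order A H)) \<longleftrightarrow>
         liminf (\<lambda>n. ereal (real (Max (H n)) / real n)) > 0"
proof
  assume "\<exists>A. finite A \<and> (basis_of_order A H \<or> asymptotic_basis_of_order A H)"
  then obtain A where "finite A" "asymptotic_basis_of_order A H"
    using basis_imp_asymptotic_basis by blast
  then show "liminf (\<lambda>n. ereal (real (Max (H n)) / real n)) > 0"
    by (rule asymptotic_basis_imp_liminf_pos[of H, OF assms(1)])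
next
  assume "liminf (\<lambda>n. ereal (real (Max (H n)) / real n)) > 0"
  then obtain m where "asymptotic_basis_of_order {..m} H"
    using liminf_pos_imp_asymptotic_basis[of H, OF assms(1,2)] by blast
  then show "\<exists>A. finite A \<and> (basis_of_order A H \<or> asymptotic_basis_of_order A H)"
    using finite_atMost by blast
qed

end
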